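(* Let $S\subseteq\mathbb{N}^d$ be a local good semigroup, $E\subsetneq S$ a proper good ideal, and suppose $A=S\setminus E$ is well-behaved. Let $I=\{1,\dots,d\}=I_1\sqcup I_2$ with $I_1,I_2$ nonempty, and for $h=1,2$ let $\pi_h$ be the projection onto the coordinates in $I_h$, $S_h=\pi_h(S)$, $E_h=\pi_h(E)$ (a good semigroup and a good ideal of it), $A^{(h)}=S_h\setminus E_h$ with levels $A^{(h)}_1,A^{(h)}_2,\dots$ computed in $S_h$. If $\boldsymbol\alpha^{(1)}\in A^{(1)}_i$, then $$\Gamma(\boldsymbol\alpha^{(1)}):=\{\boldsymbol\alpha\in S:\pi_1(\boldsymbol\alpha)=\boldsymbol\alpha^{(1)}\}\subseteq A_i.$$ Analogously, if $\boldsymbol\alpha^{(2)}\in A^{(2)}_i$, then $\{\boldsymbol\alpha\in S:\pi_2(\boldsymbol\alpha)=\boldsymbol\alpha^{(2)}\}\subseteq A_i$.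
   Context: Notation: on $\mathbb{Z}^d$, $\le$ componentwise, $<$ means $\le$ and $\ne$, $\boldsymbol\alpha\ll\boldsymbol\beta$ means $\alpha_i<\beta_i$ for all $i$, $\boldsymbol\alpha\le\le\boldsymbol\beta$ means $\boldsymbol\alpha=\boldsymbol\beta$ or $\boldsymbol\alpha\ll\boldsymbol\beta$, $\wedge$ componentwise minimum. For $T\subseteq\mathbb Z^d$, $F\subseteq I$: $\Delta^T_F(\boldsymbol\alpha)=\{\boldsymbol\beta\in T:\beta_i=\alpha_i\ (i\in F),\ \beta_j>\alpha_j\ (j\notin F)\}$, $\widetilde\Delta^T_F(\boldsymbol\alpha)=\{\boldsymbol\beta\in T:\beta_i=\alpha_i\ (i\in F),\ \beta_j\ge\alpha_j\ (j\notin F)\}\setminus\{\boldsymbol\alpha\}$. A good semigroup is a submonoid $S$ of $(\mathbb{N}^d,+)$ closed under $\wedge$ (G1), satisfying (G2): if $\boldsymbol\alpha\neq\boldsymbol\beta\in S$ and $\alpha_i=\beta_i$, there is $\boldsymbol\epsilon\in S$ with $\epsilon_i>\alpha_i$, $\epsilon_j\ge\min\{\alpha_j,\beta_j\}$ for $j\ne i$, with equality if $\alpha_j\ne\beta_j$; and (G3): $\boldsymbol c+\mathbb N^d\subseteq S$ for some $\boldsymbol c$. Local: $\boldsymbol 0$ is the only element with a zero component. A good ideal is $E\subseteq S$ with $E+S\subseteq E$ satisfying (G1)–(G3). Complete infimum: $\boldsymbol\alpha\in B\subseteq S$ is a complete infimum of $\boldsymbol\beta^{(1)},\dots,\boldsymbol\beta^{(r)}\in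 B$ ($r\ge 2$) if $\boldsymbol\beta^{(j)}\in\Delta^S_{F_j}(\boldsymbol\alpha)$ with $\emptyset\ne F_j\subsetneq I$, $\boldsymbol\beta^{(j)}\wedge\boldsymbol\beta^{(k)}=\boldsymbol\alpha$ for $j\ne k$, $\bigcap F_j=\emptyset$. Levels of $A=S\setminus E$: $B^{(1)}$ = maximal elements of $A$ for $\le\le$, $C^{(1)}$ = those that are complete infima of $r$ elements of $B^{(1)}$, $1<r\le d$, $D^{(1)}=B^{(1)}\setminus C^{(1)}$; inductively $B^{(i)}$ = maximal elements for $\le\le$ of $A\setminus\bigcup_{j<i}D^{(j)}$, $C^{(i)},D^{(i)}$ likewise; $A=\bigsqcup_{i=1}^ND^{(i)}$, levels $A_i=D^{(N+1-i)}$ (for $d=1$ these are the singletons of $A$ in increasing order). Well-behaved: $A$ is well-behaved if whenever $\boldsymbol\alpha\in S$ is a complete infimum (in $S$) of $\boldsymbol\beta^{(1)},\dots,\boldsymbol\beta^{(r)}$ with $\boldsymbol\beta^{(j)}\in\widetilde\Delta^S_{G_j}(\boldsymbol\alpha)$ and $\widetilde\Delta^S_{G_j}(\boldsymbol\alpha)\subseteq A$ for every $j$, then $\boldsymbol\alpha\in E$. *)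

theory Defs
  imports Main
begin

text \<open>Vectors of N^I (I a finite index set, here I = {1..d}) are represented as
  functions nat => nat vanishing outside I.\<close>

type_synonym vect = "nat \<Rightarrow> nat"

definition vecs :: "nat set \<Rightarrow> vect set" where
  "vecs I = {\<alpha>. \<forall>i. i \<notin> I \<longrightarrow> \<alpha> i = 0}"

definition vzero :: vect where "vzero = (\<lambda>_. 0)"

definition vadd :: "vect \<Rightarrow> vect \<Rightarrow> vect" where
  "vadd \<alpha> \<beta> = (\<lambda>i. \<alpha> i + \<beta> i)"

definition vmin :: "vect \<Rightarrow> vect \<Rightarrow> vect" where
  "vmin \<alpha> \<beta> = (\<lambda>i. min (\<alpha> i) (\<beta> i))"

definition vle :: "nat set \<Rightarrow> vect \<Rightarrow> vect \<Rightarrow> bool" where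
  "vle I \<alpha> \<beta> \<longleftrightarrow> (\<forall>i\<in>I. \<alpha> i \<le> \<beta> i)"

definition vll :: "nat set \<Rightarrow> vect \<Rightarrow> vect \<Rightarrow> bool" where
  "vll I \<alpha> \<beta> \<longleftrightarrow> (\<forall>i\<in>I. \<alpha> i < \<beta> i)"

definition vlele :: "nat set \<Rightarrow> vect \<Rightarrow> vect \<Rightarrow> bool" where
  "vlele I \<alpha> \<beta> \<longleftrightarrow> \<alpha> = \<beta> \<or> vll I \<alpha> \<beta>"

definition Delta :: "nat set \<Rightarrow> vect set \<Rightarrow> nat set \<Rightarrow> vect \<Rightarrow> vect set" where
  "Delta I T F \<alpha> = {\<beta>\<in>T. (\<forall>i\<in>F. \<beta> i = \<alpha> i) \<and> (\<forall>j\<in>I - F. \<beta> j > \<alpha> j)}"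

definition Deltat :: "nat set \<Rightarrow> vect set \<Rightarrow> nat set \<Rightarrow> vect \<Rightarrow> vect set" where
  "Deltat I T F \<alpha> = {\<beta>\<in>T. (\<forall>i\<in>F. \<beta> i = \<alpha> i) \<and> (\<forall>j\<in>I - F. \<beta> j \<ge> \<alpha> j)} - {\<alpha>}"

definition G1 :: "nat set \<Rightarrow> vect set \<Rightarrow> bool" where
  "G1 I T \<longleftrightarrow> (\<forall>\<alpha>\<in>T. \<forall>\<beta>\<in>T. vmin \<alpha> \<beta> \<in> T)"

definition G2 :: "nat set \<Rightarrow> vect set \<Rightarrow> bool" where
  "G2 I T \<longleftrightarrow> (\<forall>\<alpha>\<in>T. \<forall>\<beta>\<in>T. \<forall>i\<in>I. \<alpha> \<noteq> \<beta> \<and> \<alpha> i = \<beta> i \<longrightarrow>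
     (\<exists>\<epsilon>\<in>T. \<epsilon> i > \<alpha> i \<and>
        (\<forall>j\<in>I - {i}. \<epsilon> j \<ge> min (\<alpha> j) (\<beta> j) \<and>
                        (\<alpha> j \<noteq> \<beta> j \<longrightarrow> \<epsilon> j = min (\<alpha> j) (\<beta> j)))))"

definition G3 :: "nat set \<Rightarrow> vect set \<Rightarrow> bool" where
  "G3 I T \<longleftrightarrow> (\<exists>c\<in>vecs I. \<forall>\<gamma>\<in>vecs I. vadd c \<gamma> \<in> T)"

definition good_semigroup :: "nat set \<Rightarrow> vect set \<Rightarrow> bool" where
  "good_semigroup I S \<longleftrightarrow> S \<subseteq> vecs I \<and> vzero \<in> S \<and>
     (\<forall>\<alpha>\<in>S. \<forall>\<beta>\<in>S. vadd \<alpha> \<beta> \<in> S) \<and> G1 I S \<and> G2 I S \<and> G3 I S"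

definition local_semigroup :: "nat set \<Rightarrow> vect set \<Rightarrow> bool" where
  "local_semigroup I S \<longleftrightarrow> (\<forall>\<alpha>\<in>S. (\<exists>i\<in>I. \<alpha> i = 0) \<longrightarrow> \<alpha> = vzero)"

definition good_ideal :: "nat set \<Rightarrow> vect set \<Rightarrow> vect set \<Rightarrow> bool" where
  "good_ideal I S E \<longleftrightarrow> E \<subseteq> S \<and> (\<forall>\<alpha>\<in>E. \<forall>\<beta>\<in>S. vadd \<alpha> \<beta> \<in> E) \<and>
     G1 I E \<and> G2 I E \<and> G3 I E"

definition complete_inf :: "nat set \<Rightarrow> vect set \<Rightarrow> vect set \<Rightarrow> vect \<Rightarrow> nat \<Rightarrow>
    (nat \<Rightarrow> vect) \<Rightarrow> (nat \<Rightarrow> nat set) \<Rightarrow> bool" where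
  "complete_inf I S B \<alpha> r \<beta> F \<longleftrightarrow> \<alpha> \<in> B \<and> r \<ge> 2 \<and>
     (\<forall>j<r. \<beta> j \<in> B \<and> \<beta> j \<in> Delta I S (F j) \<alpha> \<and> F j \<noteq> {} \<and> F j \<subset> I) \<and>
     (\<forall>j<r. \<forall>k<r. j \<noteq> k \<longrightarrow> vmin (\<beta> j) (\<beta> k) = \<alpha>) \<and>
     (\<Inter>j\<in>{..<r}. F j) = {}"

definition well_behaved :: "nat set \<Rightarrow> vect set \<Rightarrow> vect set \<Rightarrow> bool" where
  "well_behaved I S E \<longleftrightarrow>
     (\<forall>\<alpha> r \<beta> F G. \<alpha> \<in> S \<and> complete_inf I S S \<alpha> r \<beta> F \<and>
        (\<forall>j<r. G j \<subseteq> I \<and> \<beta> j \<in> Deltat I S (G j) \<alpha> \<and> Deltat I S (G j) \<alpha> \<subseteq> S - E)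
        \<longrightarrow> \<alpha> \<in> E)"

definition maxl :: "nat set \<Rightarrow> vect set \<Rightarrow> vect set" where
  "maxl I X = {\<alpha>\<in>X. \<forall>\<beta>\<in>X. vlele I \<alpha> \<beta> \<longrightarrow> \<beta> = \<alpha>}"

definition Cset :: "nat set \<Rightarrow> vect set \<Rightarrow> vect set \<Rightarrow> vect set" where
  "Cset I S X = {\<alpha>\<in>maxl I X. \<exists>r \<beta> F. r \<le> card I \<and> complete_inf I S (maxl I X) \<alpha> r \<beta> F}"

definition Dset :: "nat set \<Rightarrow> vect set \<Rightarrow> vect set \<Rightarrow> vect set" where
  "Dset I S X = maxl I X - Cset I S X"

fun remA :: "nat set \<Rightarrow> vect set \<Rightarrow> vect set \<Rightarrow> nat \<Rightarrow> vect set" where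
  "remA I S A 0 = A"
| "remA I S A (Suc n) = remA I S A n - Dset I S (remA I S A n)"

definition Dlev :: "nat set \<Rightarrow> vect set \<Rightarrow> vect set \<Rightarrow> nat \<Rightarrow> vect set" where
  "Dlev I S A n = (if n = 0 then {} else Dset I S (remA I S A (n - 1)))"

definition nlev :: "nat set \<Rightarrow> vect set \<Rightarrow> vect set \<Rightarrow> nat" where
  "nlev I S A = (LEAST n. remA I S A n = {})"

definition level :: "nat set \<Rightarrow> vect set \<Rightarrow> vect set \<Rightarrow> nat \<Rightarrow> vect set" where
  "level I S A i = (if 1 \<le> i \<and> i \<le> nlev I S A then Dlev I S A (nlev I S A + 1 - i) else {})"

definition proj :: "nat set \<Rightarrow> vect \<Rightarrow> vect" where
  "proj J \<alpha> = (\<lambda>i. if i \<in> J then \<alpha> i else 0)"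

end

theory Submission
  imports Defs
begin

text \<open>
  Call a unit step \<open>x \<rightarrow> x + e\<^sub>i\<close> of a lattice path a jump if some \<open>\<gamma> \<ge> x\<close> with \<open>\<gamma>\<^sub>i = x\<^sub>i\<close> lies
  in \<open>S\<close> but none lies in \<open>E\<close>. By (G2) the number of jumps on a path from \<open>0\<close> to \<open>x\<close> depends only
  on \<open>x\<close>; call it the rank of \<open>x\<close>. For the value semigroup of a ring \<open>R\<close> and of an ideal \<open>J\<close>
  it is the length of \<open>R / (R(x) + J)\<close>. If \<open>A\<close> is well-behaved, raising all coordinates of
  an element of \<open>A\<close> by one increases the rank by exactly one, which forces the level of \<open>\<alpha> \<in> A\<close>
  to be its rank plus one. The rank with respect to a projection of \<open>(S, E)\<close> is the restriction of the rank
  with respect to \<open>(S, E)\<close>, since paths may raise the coordinates in \<open>I\<^sub>1\<close> first. Well-behavedness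
  excludes jumps between elements of a fibre over a point outside \<open>E\<^sub>1\<close>, so levels agree.
\<close>

section \<open>Potentials on the lattice\<close>

definition inc :: "nat \<Rightarrow> vect \<Rightarrow> vect" where
  "inc i x = x(i := Suc (x i))"

lemma inc_apply [simp]: "inc i x j = (if j = i then Suc (x i) else x j)"
  by (simp add: inc_def)

text \<open>Total weight of one fixed path from \<open>0\<close> to \<open>x\<close>, whose last
  step raises the least nonzero coordinate of \<open>x\<close>. The guard \<open>finite I\<close>
  makes the coordinate sum a termination measure.\<close>

function path_sum :: "nat set \<Rightarrow> (vect \<Rightarrow> nat \<Rightarrow> nat) \<Rightarrow> vect \<Rightarrow> nat" where
  "path_sum I f x = (if finite I \<and> (\<exists>i\<in>I. x i \<noteq> 0)
     then (let i = (LEAST i. i \<in> I \<and> x i \<noteq> 0); y = x(i := x i - 1) in path_sum I f y + f y i)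
     else 0)"
  by pat_completeness auto
termination
proof (relation "measure (\<lambda>(I, f, x). \<Sum>i\<in>I. x i)", goal_cases)
  case (2 I f x i y)
  then have "i \<in> I \<and> x i \<noteq> 0"
    by (metis (mono_tags, lifting) LeastI)
  with 2 have "(\<Sum>i\<in>I. y i) < (\<Sum>i\<in>I. x i)"
    by (intro sum_strict_mono_ex1) auto
  then show ?case by simp
qed simp

declare path_sum.simps [simp del]

lemma path_sum_vzero: "path_sum I f vzero = 0"
  by (subst path_sum.simps) (simp add: vzero_def)

text \<open>A discrete Poincare lemma: weights with equal sums around every unit square have a
  potential, so the fixed path may be replaced by any other.\<close>

lemma path_sum_inc:
  assumes fin: "finite I"
    and square: "\<And>x i j. i \<in> I \<Longrightarrow> j \<in> I \<Longrightarrow> i \<noteq> j \<Longrightarrow> f x i + f (inc i x) j = f x j + f (inc j x) i"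
    and i: "i \<in> I"
  shows "path_sum I f (inc i x) = path_sum I f x + f x i"
  using i
proof (induction "\<Sum>k\<in>I. x k" arbitrary: x i rule: less_induct)
  case less
  \<comment> \<open>\<open>k\<close> is the coordinate raised last on the fixed path to
    \<open>inc i x\<close>. For \<open>k = i\<close> the claim is the recursion itself.\<close>
  define k where "k = (LEAST k. k \<in> I \<and> inc i x k \<noteq> 0)"
  have k: "k \<in> I" "inc i x k \<noteq> 0"
  proof -
    have "i \<in> I \<and> inc i x i \<noteq> 0" using less by simp
    from LeastI[of "\<lambda>k. k \<in> I \<and> inc i x k \<noteq> 0", OF this]
    show "k \<in> I" "inc i x k \<noteq> 0" unfolding k_def by blast+
  qed
  define y where "y = (inc i x)(k := inc i x k - 1)"
  have cond: "finite I \<and> (\<exists>j\<in>I. inc i x j \<noteq> 0)"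
    using fin less by (auto intro: bexI[of _ i])
  have *: "path_sum I f (inc i x) = path_sum I f y + f y k"
    unfolding y_def k_def by (subst path_sum.simps) (simp only: cond if_True Let_def simp_thms)
  show ?case
  proof (cases "k = i")
    case True
    then have "y = x" by (auto simp: y_def fun_eq_iff)
    with * True show ?thesis by simp
  next
    case False
    \<comment> \<open>\<open>z\<close> is the bottom corner of the square with directions
      \<open>i\<close>, \<open>k\<close> and top \<open>inc i x\<close>. The induction hypothesis
      covers both edges leaving \<open>z\<close>.\<close>
    define z where "z = x(k := x k - 1)"
    from False k have xk: "x k \<noteq> 0" by simp
    have y: "y = inc i z" and x: "x = inc k z"
      using False xk by (auto simp: y_def z_def fun_eq_iff)
    have lt: "(\<Sum>k\<in>I. z k) < (\<Sum>k\<in>I. x k)"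
      using fin k(1) xk by (intro sum_strict_mono_ex1) (auto simp: z_def)
    have "path_sum I f y = path_sum I f z + f z i"
      unfolding y by (rule less.hyps[OF lt less.prems])
    moreover have "path_sum I f x = path_sum I f z + f z k"
      by (subst x) (rule less.hyps[OF lt k(1)])
    ultimately show ?thesis
      using * square[of i k z] False k(1) less.prems x y by simp
  qed
qed

text \<open>Turns facts about single steps, above all the absence of jumps, into facts about
  \<open>x \<le> y\<close>. Here \<open>\<le>\<close> is the order of functions, which on
  \<open>vecs I\<close> is \<open>vle I\<close>.\<close>

lemma path_induct:
  assumes "finite I" "y \<in> vecs I" "x \<le> y"
    and base: "P x"
    and step: "\<And>z i. i \<in> I \<Longrightarrow> x \<le> z \<Longrightarrow> z \<le> y \<Longrightarrow> z i < y i \<Longrightarrow> P z \<Longrightarrow> P (inc i z)"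
  shows "P y"
proof -
  have "P y" if "x \<le> z" "z \<le> y" "P z" for z
    using that
  proof (induction "\<Sum>i\<in>I. y i - z i" arbitrary: z rule: less_induct)
    case less
    show ?case
    proof (cases "\<exists>i\<in>I. z i < y i")
      case True
      then obtain i where i: "i \<in> I" "z i < y i" by blast
      have "(\<Sum>k\<in>I. y k - inc i z k) < (\<Sum>k\<in>I. y k - z k)"
        using assms(1) i by (intro sum_strict_mono_ex1) auto
      moreover have "x \<le> inc i z" "inc i z \<le> y"
        using less.prems i by (auto simp: le_fun_def intro: le_SucI)
      ultimately show ?thesis using less step[of i z] i by blast
    next
      case False
      have "z k = y k" for k
        using False le_funD[OF less.prems(2), of k] assms(2)
        by (cases "k \<in> I") (auto simp: vecs_def not_less intro: le_antisym)
      then have "z = y" by blast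
      with less show ?thesis by simp
    qed
  qed
  then show ?thesis using assms(3) base by blast
qed

lemma inc_le: "x \<le> y \<Longrightarrow> x i < y i \<Longrightarrow> inc i x \<le> y"
  by (auto simp: le_fun_def)

lemma le_inc: "x \<le> inc i x"
  by (auto simp: le_fun_def)

lemma vecs_le:
  assumes "x \<le> y" "y \<in> vecs I"
  shows "x \<in> vecs I"
proof -
  have "x i = 0" if "i \<notin> I" for i
    using le_funD[OF assms(1), of i] assms(2) that by (simp add: vecs_def)
  then show ?thesis by (simp add: vecs_def)
qed

lemma inc_vecs: "x \<in> vecs I \<Longrightarrow> i \<in> I \<Longrightarrow> inc i x \<in> vecs I"
  by (auto simp: vecs_def)

section \<open>The rank of a pair of good sets\<close>

text \<open>Equivalently, the part of \<open>T\<close> above \<open>x\<close> shrinks when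
  coordinate \<open>i\<close> of \<open>x\<close> is raised by one: a proper step of a
  filtration.\<close>

definition attains :: "vect set \<Rightarrow> vect \<Rightarrow> nat \<Rightarrow> bool" where
  "attains T x i \<longleftrightarrow> (\<exists>\<gamma>\<in>T. x \<le> \<gamma> \<and> \<gamma> i = x i)"

definition jump :: "vect set \<Rightarrow> vect set \<Rightarrow> vect \<Rightarrow> nat \<Rightarrow> bool" where
  "jump S E x i \<longleftrightarrow> attains S x i \<and> \<not> attains E x i"

definition rank :: "nat set \<Rightarrow> vect set \<Rightarrow> vect set \<Rightarrow> vect \<Rightarrow> nat" where
  "rank I S E = path_sum I (\<lambda>x i. of_bool (jump S E x i))"

section \<open>Exchanging two steps by (G2)\<close>

lemma attains_antimono: "attains T y i \<Longrightarrow> x \<le> y \<Longrightarrow> x i = y i \<Longrightarrow> attains T x i"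
  unfolding attains_def by (metis order_trans)

lemma G2_elim:
  assumes "G2 I T" "T \<subseteq> vecs I" "\<alpha> \<in> T" "\<beta> \<in> T" "i \<in> I" "\<alpha> \<noteq> \<beta>" "\<alpha> i = \<beta> i"
  obtains \<epsilon> where "\<epsilon> \<in> T" "\<alpha> i < \<epsilon> i" "vmin \<alpha> \<beta> \<le> \<epsilon>" "\<And>j. \<alpha> j \<noteq> \<beta> j \<Longrightarrow> \<epsilon> j = min (\<alpha> j) (\<beta> j)"
proof -
  from assms obtain \<epsilon> where \<epsilon>: "\<epsilon> \<in> T" "\<alpha> i < \<epsilon> i"
    "\<And>j. j \<in> I - {i} \<Longrightarrow> min (\<alpha> j) (\<beta> j) \<le> \<epsilon> j \<and> (\<alpha> j \<noteq> \<beta> j \<longrightarrow> \<epsilon> j = min (\<alpha> j) (\<beta> j))"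
    unfolding G2_def by metis
  have out: "\<alpha> j = 0" "\<beta> j = 0" if "j \<notin> I" for j
    using assms(2-4) that by (auto simp: vecs_def)
  show thesis
  proof
    show "vmin \<alpha> \<beta> \<le> \<epsilon>" unfolding le_fun_def vmin_def
    proof
      fix j show "min (\<alpha> j) (\<beta> j) \<le> \<epsilon> j"
        using out[of j] \<epsilon>(2) \<epsilon>(3)[of j] by (cases "j = i"; cases "j \<in> I") auto
    qed
    show "\<epsilon> j = min (\<alpha> j) (\<beta> j)" if "\<alpha> j \<noteq> \<beta> j" for j
      using that out[of j] \<epsilon>(3)[of j] assms(7) by (cases "j = i"; cases "j \<in> I") auto
  qed (use \<epsilon> in auto)
qed

text \<open>If raising \<open>i\<close> destroys attainment at \<open>j\<close>, a witness
  \<open>\<gamma>\<close> at \<open>j\<close> must have \<open>\<gamma> i = x i\<close>, so it also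
  witnesses \<open>i\<close>. A witness at \<open>i\<close> above \<open>inc j x\<close> would
  combine with \<open>\<gamma>\<close> by (G2) at \<open>i\<close> into an element restoring
  attainment at \<open>j\<close>.\<close>

lemma attains_exchange:
  assumes "G2 I T" "T \<subseteq> vecs I" "i \<in> I" "i \<noteq> j"
    and "attains T x j" "\<not> attains T (inc i x) j"
  shows "attains T x i" "\<not> attains T (inc j x) i"
proof -
  from assms obtain \<gamma> where \<gamma>: "\<gamma> \<in> T" "x \<le> \<gamma>" "\<gamma> j = x j" by (auto simp: attains_def)
  have eq: "\<gamma> i = x i"
  proof (rule ccontr)
    assume "\<gamma> i \<noteq> x i"
    with \<gamma> have "inc i x \<le> \<gamma>" by (metis inc_le le_funD order_neq_le_trans)
    with \<gamma> assms show False by (auto simp: attains_def)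
  qed
  with \<gamma> show "attains T x i" by (auto simp: attains_def)
  show "\<not> attains T (inc j x) i"
  proof
    assume "attains T (inc j x) i"
    then obtain \<delta> where \<delta>: "\<delta> \<in> T" "inc j x \<le> \<delta>" "\<delta> i = x i"
      using assms(4) by (auto simp: attains_def)
    have \<delta>j: "x j < \<delta> j" using le_funD[OF \<delta>(2), of j] by simp
    have x\<delta>: "x \<le> \<delta>" using le_inc \<delta>(2) by (rule order_trans)
    have "\<gamma> \<noteq> \<delta>" "\<gamma> i = \<delta> i" using \<delta>j \<gamma> eq \<delta> by auto
    from G2_elim[OF assms(1,2) \<gamma>(1) \<delta>(1) assms(3) this]
    obtain \<epsilon> where \<epsilon>: "\<epsilon> \<in> T" "\<gamma> i < \<epsilon> i" "vmin \<gamma> \<delta> \<le> \<epsilon>"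
      "\<And>j. \<gamma> j \<noteq> \<delta> j \<Longrightarrow> \<epsilon> j = min (\<gamma> j) (\<delta> j)" by blast
    have "x \<le> vmin \<gamma> \<delta>" using \<gamma>(2) x\<delta> by (auto simp: vmin_def le_fun_def)
    then have "inc i x \<le> \<epsilon>" using \<epsilon>(2,3) eq by (intro inc_le) auto
    moreover have "\<epsilon> j = x j" using \<epsilon>(4)[of j] \<gamma>(3) \<delta>j by simp
    ultimately show False using assms(4,6) \<epsilon>(1) by (auto simp: attains_def)
  qed
qed

text \<open>A step in another direction can only lose attainment, and by the exchange lemma the loss
  is symmetric in \<open>i\<close> and \<open>j\<close>.\<close>

lemma attains_square:
  assumes "G2 I T" "T \<subseteq> vecs I" "i \<in> I" "j \<in> I" "i \<noteq> j"
  shows "(of_bool (attains T x i) + of_bool (attains T (inc i x) j) :: nat) =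
    of_bool (attains T x j) + of_bool (attains T (inc j x) i)"
proof -
  have "attains T (inc i x) j \<Longrightarrow> attains T x j" "attains T (inc j x) i \<Longrightarrow> attains T x i"
    using assms(5) by (auto elim!: attains_antimono simp: le_inc)
  moreover have "attains T x j \<and> \<not> attains T (inc i x) j \<longleftrightarrow> attains T x i \<and> \<not> attains T (inc j x) i"
    using attains_exchange[OF assms(1-3,5), of x]
      attains_exchange[OF assms(1,2,4) assms(5)[symmetric], of x] by blast
  ultimately show ?thesis
    unfolding of_bool_def by (simp split: if_split) blast
qed

text \<open>The common setting of \<open>(S, E)\<close> and its projections, so that facts on the
  rank are available for both.\<close>

locale good_pair =
  fixes I :: "nat set" and S E :: "vect set"
  assumes finI: "finite I" and SI: "S \<subseteq> vecs I" and ES: "E \<subseteq> S"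
    and G1S: "G1 I S" and G2S: "G2 I S" and G1E: "G1 I E" and G2E: "G2 I E" and G3E: "G3 I E"
begin

lemma EI: "E \<subseteq> vecs I"
  using SI ES by blast

lemma rank_inc:
  assumes "i \<in> I"
  shows "rank I S E (inc i x) = rank I S E x + of_bool (jump S E x i)"
  unfolding rank_def
proof (rule path_sum_inc[OF finI _ assms])
  fix x i j assume ij: "i \<in> I" "j \<in> I" "i \<noteq> j"
  \<comment> \<open>Attainment by \<open>E\<close> implies attainment by \<open>S\<close>, so the
    jump indicator is a difference and the two square identities can be subtracted.\<close>
  have *: "(of_bool (attains S x i) :: nat) = of_bool (attains E x i) + of_bool (jump S E x i)" for x i
    using ES by (auto simp: jump_def attains_def)
  from attains_square[OF G2S SI ij, of x] attains_square[OF G2E EI ij, of x]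
  show "(of_bool (jump S E x i) + of_bool (jump S E (inc i x) j) :: nat) =
    of_bool (jump S E x j) + of_bool (jump S E (inc j x) i)"
    unfolding * by linarith
qed

lemma rank_mono:
  assumes "x \<le> y" "y \<in> vecs I"
  shows "rank I S E x \<le> rank I S E y"
proof (rule path_induct[OF finI assms(2,1), where P = "\<lambda>z. rank I S E x \<le> rank I S E z"])
  fix z i assume "i \<in> I" "rank I S E x \<le> rank I S E z"
  then show "rank I S E x \<le> rank I S E (inc i z)" by (simp only: rank_inc)
qed simp

lemma rank_jump_less:
  assumes "i \<in> I" "jump S E x i" "x \<le> y" "y \<in> vecs I" "x i < y i"
  shows "rank I S E x < rank I S E y"
  using rank_mono[OF inc_le[OF assms(3,5)] assms(4)] assms(1,2) by (simp add: rank_inc)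

lemma rank_eqI:
  assumes "x \<le> y" "y \<in> vecs I"
    and "\<And>z i. i \<in> I \<Longrightarrow> x \<le> z \<Longrightarrow> z \<le> y \<Longrightarrow> z i < y i \<Longrightarrow> rank I S E z = rank I S E x \<Longrightarrow> \<not> jump S E z i"
  shows "rank I S E y = rank I S E x"
proof (rule path_induct[OF finI assms(2,1), where P = "\<lambda>z. rank I S E z = rank I S E x"])
  fix z i assume "i \<in> I" "x \<le> z" "z \<le> y" "z i < y i" "rank I S E z = rank I S E x"
  then show "rank I S E (inc i z) = rank I S E x" using assms(3)[of i z] by (simp add: rank_inc)
qed simp

section \<open>The conductor and least elements above a point\<close>

lemma conductorE:
  obtains c where "c \<in> vecs I" "\<And>x. x \<in> vecs I \<Longrightarrow> c \<le> x \<Longrightarrow> x \<in> E"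
proof -
  from G3E obtain c where c: "c \<in> vecs I" "\<And>\<gamma>. \<gamma> \<in> vecs I \<Longrightarrow> vadd c \<gamma> \<in> E"
    by (auto simp: G3_def)
  show thesis
  proof (rule that[OF c(1)])
    fix x assume x: "x \<in> vecs I" "c \<le> x"
    have "vadd c (\<lambda>i. x i - c i) = x" using x(2) by (auto simp: vadd_def le_fun_def)
    moreover have "(\<lambda>i. x i - c i) \<in> vecs I" using x(1) by (auto simp: vecs_def)
    ultimately show "x \<in> E" using c(2) by metis
  qed
qed

text \<open>The conductor provides some element above \<open>x\<close>. One of least coordinate sum
  is least outright, as otherwise (G1) would give a minimum of smaller sum.\<close>

lemma least_above_ex:
  assumes "G1 I T" "E \<subseteq> T" "T \<subseteq> vecs I" "x \<in> vecs I"
  obtains \<nu> where "\<nu> \<in> T" "x \<le> \<nu>" "\<And>\<gamma>. \<gamma> \<in> T \<Longrightarrow> x \<le> \<gamma> \<Longrightarrow> \<nu> \<le> \<gamma>"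
proof -
  obtain c where c: "c \<in> vecs I" "\<And>x. x \<in> vecs I \<Longrightarrow> c \<le> x \<Longrightarrow> x \<in> E" using conductorE by blast
  have "(\<lambda>i. max (c i) (x i)) \<in> T"
    using c(1) assms(2,4) by (intro subsetD[OF assms(2)] c(2)) (auto simp: vecs_def le_fun_def)
  then have "\<exists>\<gamma>. \<gamma> \<in> T \<and> x \<le> \<gamma>" by (auto simp: le_fun_def)
  then obtain \<nu> where \<nu>: "\<nu> \<in> T" "x \<le> \<nu>"
    and min: "\<And>\<gamma>. \<gamma> \<in> T \<Longrightarrow> x \<le> \<gamma> \<Longrightarrow> (\<Sum>i\<in>I. \<nu> i) \<le> (\<Sum>i\<in>I. \<gamma> i)"
    using ex_has_least_nat[of "\<lambda>\<gamma>. \<gamma> \<in> T \<and> x \<le> \<gamma>" _ "\<lambda>\<gamma>. \<Sum>i\<in>I. \<gamma> i"] by blast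
  show thesis
  proof (rule that[OF \<nu>])
    fix \<gamma> assume \<gamma>: "\<gamma> \<in> T" "x \<le> \<gamma>"
    show "\<nu> \<le> \<gamma>"
    proof (rule le_funI, rule ccontr)
      fix k assume k: "\<not> \<nu> k \<le> \<gamma> k"
      then have "k \<in> I" using \<nu>(1) assms(3) by (force simp: vecs_def)
      then have "(\<Sum>i\<in>I. vmin \<nu> \<gamma> i) < (\<Sum>i\<in>I. \<nu> i)"
        using k finI by (intro sum_strict_mono_ex1) (auto simp: vmin_def intro!: bexI[of _ k])
      moreover have "vmin \<nu> \<gamma> \<in> T" "x \<le> vmin \<nu> \<gamma>"
        using assms(1) \<nu> \<gamma> by (auto simp: G1_def vmin_def le_fun_def)
      ultimately show False using min by (meson not_le)
    qed
  qed
qed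

definition up :: "vect \<Rightarrow> vect" where
  "up x = (SOME \<nu>. \<nu> \<in> S \<and> x \<le> \<nu> \<and> (\<forall>\<gamma>\<in>S. x \<le> \<gamma> \<longrightarrow> \<nu> \<le> \<gamma>))"

lemma up:
  assumes "x \<in> vecs I"
  shows "up x \<in> S" "x \<le> up x" "\<And>\<gamma>. \<gamma> \<in> S \<Longrightarrow> x \<le> \<gamma> \<Longrightarrow> up x \<le> \<gamma>"
proof -
  have "\<exists>\<nu>. \<nu> \<in> S \<and> x \<le> \<nu> \<and> (\<forall>\<gamma>\<in>S. x \<le> \<gamma> \<longrightarrow> \<nu> \<le> \<gamma>)"
    using least_above_ex[OF G1S ES SI assms] by metis
  from someI_ex[OF this]
  show "up x \<in> S" "x \<le> up x" "\<And>\<gamma>. \<gamma> \<in> S \<Longrightarrow> x \<le> \<gamma> \<Longrightarrow> up x \<le> \<gamma>"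
    unfolding up_def by blast+
qed

text \<open>A path from \<open>x\<close> to \<open>up x\<close> has no jump: an element of
  \<open>S\<close> attaining one of its steps would lie above \<open>x\<close>, hence above
  \<open>up x\<close>, yet be smaller in the direction of the step.\<close>

lemma rank_up:
  assumes "x \<in> vecs I"
  shows "rank I S E (up x) = rank I S E x"
proof (rule rank_eqI)
  show "x \<le> up x" "up x \<in> vecs I" using up[OF assms] SI by auto
  fix z i assume z: "x \<le> z" "z \<le> up x" "z i < up x i"
  show "\<not> jump S E z i"
  proof
    assume "jump S E z i"
    then obtain \<gamma> where \<gamma>: "\<gamma> \<in> S" "z \<le> \<gamma>" "\<gamma> i = z i" by (auto simp: jump_def attains_def)
    from up(3)[OF assms \<gamma>(1)] z(1) \<gamma>(2) have "up x \<le> \<gamma>" by (meson order_trans)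
    then show False using z(3) \<gamma>(3) by (metis le_funD not_le)
  qed
qed

text \<open>Without jumps \<open>E\<close> would attain every direction at \<open>\<alpha>\<close>;
  the least element of \<open>E\<close> above \<open>\<alpha>\<close> would then be
  \<open>\<alpha>\<close> itself.\<close>

lemma ex_jump:
  assumes "\<alpha> \<in> S - E"
  obtains i where "i \<in> I" "jump S E \<alpha> i"
proof (rule ccontr)
  assume "\<not> thesis"
  then have "\<forall>i\<in>I. \<not> jump S E \<alpha> i" using that by blast
  then have *: "attains E \<alpha> i" if "i \<in> I" for i
    using assms that by (auto simp: jump_def attains_def)
  have \<alpha>: "\<alpha> \<in> vecs I" using assms SI by auto
  obtain \<nu> where \<nu>: "\<nu> \<in> E" "\<alpha> \<le> \<nu>" "\<And>\<gamma>. \<gamma> \<in> E \<Longrightarrow> \<alpha> \<le> \<gamma> \<Longrightarrow> \<nu> \<le> \<gamma>"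
    using least_above_ex[OF G1E order_refl EI \<alpha>] by metis
  have "\<nu> i \<le> \<alpha> i" for i
  proof (cases "i \<in> I")
    case True
    from *[OF True] show ?thesis unfolding attains_def using \<nu>(3) by (metis le_funD)
  next
    case False
    then show ?thesis using \<nu>(1) EI by (auto simp: vecs_def)
  qed
  then have "\<nu> = \<alpha>" using \<nu>(2) by (auto intro: antisym le_funI)
  then show False using \<nu>(1) assms by simp
qed

lemma rank_vll:
  assumes "\<alpha> \<in> S - E" "\<beta> \<in> S" "vll I \<alpha> \<beta>"
  shows "rank I S E \<alpha> < rank I S E \<beta>"
proof -
  obtain i where "i \<in> I" "jump S E \<alpha> i" using ex_jump assms(1) by blast
  moreover have "\<alpha> \<le> \<beta>"
  proof (rule le_funI)
    fix k show "\<alpha> k \<le> \<beta> k"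
      using assms SI by (cases "k \<in> I") (auto simp: vll_def vecs_def intro: less_imp_le)
  qed
  ultimately show ?thesis using rank_jump_less assms SI by (auto simp: vll_def)
qed

text \<open>Since the \<open>F j\<close> have empty intersection, the direction of a jump at
  \<open>\<alpha>\<close> lies outside some \<open>F j\<close>, and there \<open>\<beta> j\<close>
  is strictly larger.\<close>

lemma rank_complete_inf:
  assumes "complete_inf I S B \<alpha> r \<beta> F" "B \<subseteq> S - E"
  shows "\<exists>j<r. rank I S E \<alpha> < rank I S E (\<beta> j)"
proof -
  from assms have "\<alpha> \<in> S - E" by (auto simp: complete_inf_def)
  then obtain i where i: "i \<in> I" "jump S E \<alpha> i" using ex_jump by blast
  from assms(1) have "i \<notin> (\<Inter>j\<in>{..<r}. F j)" by (simp add: complete_inf_def)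
  then obtain j where j: "j < r" "i \<notin> F j" by auto
  have \<beta>: "\<beta> j \<in> S" "\<beta> j \<in> Delta I S (F j) \<alpha>"
    using assms(1) j by (auto simp: complete_inf_def Delta_def)
  have "\<alpha> \<le> \<beta> j"
  proof (rule le_funI)
    fix k show "\<alpha> k \<le> \<beta> j k"
      using \<beta> SI \<open>\<alpha> \<in> S - E\<close>
      by (cases "k \<in> I"; cases "k \<in> F j") (auto simp: Delta_def vecs_def intro: less_imp_le)
  qed
  moreover have "\<alpha> i < \<beta> j i" using \<beta> i j by (auto simp: Delta_def)
  ultimately have "rank I S E \<alpha> < rank I S E (\<beta> j)"
    using rank_jump_less[OF i] \<beta> SI by blast
  then show ?thesis using j by blast
qed

text \<open>\<open>N\<close> is the rank of a conductor \<open>c\<close>, above which all points lie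
  in \<open>E\<close> and no jumps occur. A point \<open>x\<close> of smaller rank must meet a first
  jump on the way to its maximum with \<open>c\<close>.\<close>

lemma rank_boundE:
  obtains N where "\<And>\<alpha>. \<alpha> \<in> S - E \<Longrightarrow> rank I S E \<alpha> < N"
    and "\<And>x. x \<in> vecs I \<Longrightarrow> rank I S E x < N \<Longrightarrow>
      \<exists>\<beta>\<in>S - E. x \<le> \<beta> \<and> rank I S E \<beta> = rank I S E x"
proof -
  obtain c where c: "c \<in> vecs I" "\<And>x. x \<in> vecs I \<Longrightarrow> c \<le> x \<Longrightarrow> x \<in> E" using conductorE by blast
  define m where "m x = (\<lambda>i. max (x i) (c i))" for x :: vect
  have m: "x \<le> m x" "c \<le> m x" for x by (auto simp: m_def le_fun_def)
  have mI: "m x \<in> vecs I" if "x \<in> vecs I" for x using that c(1) by (auto simp: m_def vecs_def)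
  have rank_m: "rank I S E (m x) = rank I S E c" if "x \<in> vecs I" for x
  proof (rule rank_eqI[OF m(2) mI[OF that]])
    fix z i assume z: "c \<le> z" "z \<le> m x"
    then have "z \<in> E" using c(2) vecs_le mI that by blast
    then show "\<not> jump S E z i" by (auto simp: jump_def attains_def)
  qed
  show thesis
  proof (rule that[of "rank I S E c"])
    fix \<alpha> assume \<alpha>: "\<alpha> \<in> S - E"
    obtain i where i: "i \<in> I" "jump S E \<alpha> i" using ex_jump \<alpha> by blast
    have \<alpha>I: "inc i \<alpha> \<in> vecs I" using \<alpha> SI i inc_vecs by blast
    have "\<alpha> \<le> m (inc i \<alpha>)" "\<alpha> i < m (inc i \<alpha>) i"
      using order_trans[OF le_inc m(1)[of "inc i \<alpha>"]] by (auto simp: m_def)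
    then show "rank I S E \<alpha> < rank I S E c"
      using rank_jump_less[OF i] mI[OF \<alpha>I] rank_m[OF \<alpha>I] by metis
  next
    fix x assume x: "x \<in> vecs I" "rank I S E x < rank I S E c"
    have "\<not> (\<forall>z i. i \<in> I \<longrightarrow> x \<le> z \<longrightarrow> z \<le> m x \<longrightarrow> rank I S E z = rank I S E x \<longrightarrow> \<not> jump S E z i)"
    proof
      assume "\<forall>z i. i \<in> I \<longrightarrow> x \<le> z \<longrightarrow> z \<le> m x \<longrightarrow> rank I S E z = rank I S E x \<longrightarrow> \<not> jump S E z i"
      then have "rank I S E (m x) = rank I S E x" by (intro rank_eqI[OF m(1) mI[OF x(1)]]) blast
      then show False using x rank_m by simp
    qed
    then obtain z i where z: "i \<in> I" "x \<le> z" "z \<le> m x" "rank I S E z = rank I S E x" "jump S E z i"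
      by blast
    have zI: "z \<in> vecs I" using z(3) vecs_le mI x(1) by blast
    from z(5) obtain \<gamma> where \<gamma>: "\<gamma> \<in> S" "z \<le> \<gamma>" "\<gamma> i = z i" by (auto simp: jump_def attains_def)
    \<comment> \<open>Passing to \<open>up z\<close> keeps coordinate \<open>i\<close>, and the jump
      forbids elements of \<open>E\<close> above \<open>z\<close> with this coordinate.\<close>
    have "up z i = z i" using up[OF zI] \<gamma> by (metis le_funD le_antisym)
    then have "up z \<in> S - E" using z(5) up[OF zI] by (auto simp: jump_def attains_def)
    then show "\<exists>\<beta>\<in>S - E. x \<le> \<beta> \<and> rank I S E \<beta> = rank I S E x"
      using rank_up[OF zI] z(2,4) up(2)[OF zI] order_trans by metis
  qed
qed

end

section \<open>Levels as fibres of a rank function\<close>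

text \<open>Each stage strips exactly the elements of top value: \<open>less\<close> makes them
  maximal, \<open>cinf\<close> prevents them from being complete infima of remaining elements, and
  \<open>succ\<close> keeps all others from being maximal.\<close>

lemma level_eq_rank:
  assumes less: "\<And>\<alpha> \<beta>. \<alpha> \<in> A \<Longrightarrow> \<beta> \<in> A \<Longrightarrow> vll I \<alpha> \<beta> \<Longrightarrow> \<rho> \<alpha> < (\<rho> \<beta> :: nat)"
    and cinf: "\<And>\<alpha> B r \<beta> F. B \<subseteq> A \<Longrightarrow> complete_inf I S B \<alpha> r \<beta> F \<Longrightarrow> \<exists>j<r. \<rho> \<alpha> < \<rho> (\<beta> j)"
    and bound: "\<And>\<alpha>. \<alpha> \<in> A \<Longrightarrow> \<rho> \<alpha> < N"
    and succ: "\<And>\<alpha>. \<alpha> \<in> A \<Longrightarrow> Suc (\<rho> \<alpha>) < N \<Longrightarrow> \<exists>\<beta>\<in>A. vll I \<alpha> \<beta> \<and> \<rho> \<beta> = Suc (\<rho> \<alpha>)"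
    and zero: "\<exists>\<alpha>\<in>A. \<rho> \<alpha> = 0"
  shows "level I S A i = {\<alpha>\<in>A. Suc (\<rho> \<alpha>) = i}"
proof -
  have D: "Dset I S {\<alpha>\<in>A. \<rho> \<alpha> + n < N} = {\<alpha>\<in>A. Suc (\<rho> \<alpha> + n) = N}" (is "Dset I S ?X = ?Y") for n
  proof
    show "Dset I S ?X \<subseteq> ?Y"
    proof
      fix \<alpha> assume "\<alpha> \<in> Dset I S ?X"
      then have max: "\<alpha> \<in> maxl I ?X" by (simp add: Dset_def)
      then have \<alpha>: "\<alpha> \<in> A" "\<rho> \<alpha> + n < N" by (auto simp: maxl_def)
      have "\<not> Suc (\<rho> \<alpha> + n) < N"
      proof
        assume lt: "Suc (\<rho> \<alpha> + n) < N"
        then obtain \<beta> where \<beta>: "\<beta> \<in> A" "vll I \<alpha> \<beta>" "\<rho> \<beta> = Suc (\<rho> \<alpha>)" using succ[OF \<alpha>(1)] by auto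
        then have "\<beta> = \<alpha>" using max lt by (auto simp: maxl_def vlele_def)
        then show False using \<beta>(3) by simp
      qed
      then show "\<alpha> \<in> ?Y" using \<alpha> by auto
    qed
    show "?Y \<subseteq> Dset I S ?X"
    proof
      fix \<alpha> assume \<alpha>: "\<alpha> \<in> ?Y"
      have "\<beta> = \<alpha>" if "\<beta> \<in> ?X" "vlele I \<alpha> \<beta>" for \<beta>
        using that \<alpha> less[of \<alpha> \<beta>] by (auto simp: vlele_def)
      then have "\<alpha> \<in> maxl I ?X" using \<alpha> by (auto simp: maxl_def)
      moreover have "\<alpha> \<notin> Cset I S ?X"
      proof
        assume "\<alpha> \<in> Cset I S ?X"
        then obtain r \<beta> F where c: "complete_inf I S (maxl I ?X) \<alpha> r \<beta> F" by (auto simp: Cset_def)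
        have "maxl I ?X \<subseteq> A" by (auto simp: maxl_def)
        from cinf[OF this c] obtain j where j: "j < r" "\<rho> \<alpha> < \<rho> (\<beta> j)" by blast
        have "\<beta> j \<in> ?X" using c j(1) by (auto simp: complete_inf_def maxl_def)
        then show False using j \<alpha> by auto
      qed
      ultimately show "\<alpha> \<in> Dset I S ?X" by (simp add: Dset_def)
    qed
  qed
  have rem: "remA I S A n = {\<alpha>\<in>A. \<rho> \<alpha> + n < N}" for n
  proof (induction n)
    case 0
    then show ?case using bound by auto
  next
    case (Suc n)
    show ?case unfolding remA.simps Suc D by auto
  qed
  \<comment> \<open>An element of value \<open>0\<close> survives every stage before
    \<open>N\<close>, so there are no fewer than \<open>N\<close> stages. This anchors the numbering
    from below.\<close>
  have "nlev I S A = N" unfolding nlev_def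
  proof (rule Least_equality)
    show "remA I S A N = {}" by (simp add: rem)
    show "N \<le> n" if "remA I S A n = {}" for n
      using that zero by (auto simp: rem intro!: leI)
  qed
  then have "level I S A i = Dset I S (remA I S A (N - i))" if "1 \<le> i" "i \<le> N"
    using that by (simp add: level_def Dlev_def)
  then have inside: "level I S A i = {\<alpha>\<in>A. Suc (\<rho> \<alpha> + (N - i)) = N}" if "1 \<le> i" "i \<le> N"
    using that unfolding rem D by blast
  have outside: "level I S A i = {}" if "\<not> (1 \<le> i \<and> i \<le> N)"
    using that \<open>nlev I S A = N\<close> by (auto simp: level_def)
  show ?thesis
  proof (cases "1 \<le> i \<and> i \<le> N")
    case True
    then have "Suc (n + (N - i)) = N \<longleftrightarrow> Suc n = i" for n by arith
    with True inside show ?thesis by simp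
  next
    case False
    have "Suc (\<rho> \<alpha>) \<noteq> i" if "\<alpha> \<in> A" for \<alpha> using bound[OF that] False by auto
    with outside[OF False] show ?thesis by auto
  qed
qed

section \<open>Consequences of well-behavedness\<close>

locale well_behaved_pair = good_pair +
  assumes wb: "well_behaved I S E"
begin

text \<open>If \<open>up (inc j \<alpha>)\<close> kept coordinate \<open>i\<close>, (G2) at
  \<open>i\<close> applied to it and \<open>\<alpha>\<close> would give an element above
  \<open>inc i \<alpha>\<close> that keeps coordinate \<open>j\<close>, against the minimality of
  \<open>up (inc i \<alpha>)\<close>.\<close>

lemma up_inc_symmetric:
  assumes \<alpha>: "\<alpha> \<in> S" and i: "i \<in> I" and j: "j \<in> I" and less: "\<alpha> j < up (inc i \<alpha>) j"
  shows "\<alpha> i < up (inc j \<alpha>) i"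
proof (rule ccontr)
  assume not: "\<not> \<alpha> i < up (inc j \<alpha>) i"
  have I: "inc i \<alpha> \<in> vecs I" "inc j \<alpha> \<in> vecs I" using \<alpha> SI i j inc_vecs by blast+
  define \<nu> where "\<nu> = up (inc j \<alpha>)"
  have \<nu>: "\<nu> \<in> S" "inc j \<alpha> \<le> \<nu>" using up[OF I(2)] by (auto simp: \<nu>_def)
  have "\<alpha> \<le> \<nu>" using le_inc \<nu>(2) by (rule order_trans)
  have \<nu>i: "\<alpha> i = \<nu> i" using not le_funD[OF \<open>\<alpha> \<le> \<nu>\<close>, of i] by (simp add: \<nu>_def)
  have \<nu>j: "\<alpha> j < \<nu> j" using le_funD[OF \<nu>(2), of j] by simp
  then have "\<alpha> \<noteq> \<nu>" by auto
  from G2_elim[OF G2S SI \<alpha> \<nu>(1) i this \<nu>i]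
  obtain \<epsilon> where \<epsilon>: "\<epsilon> \<in> S" "\<alpha> i < \<epsilon> i" "vmin \<alpha> \<nu> \<le> \<epsilon>"
    "\<And>j. \<alpha> j \<noteq> \<nu> j \<Longrightarrow> \<epsilon> j = min (\<alpha> j) (\<nu> j)" by blast
  have "vmin \<alpha> \<nu> = \<alpha>" using \<open>\<alpha> \<le> \<nu>\<close> by (auto simp: vmin_def le_fun_def min_def)
  then have "inc i \<alpha> \<le> \<epsilon>" using \<epsilon> by (intro inc_le) auto
  then have "up (inc i \<alpha>) \<le> \<epsilon>" using up(3)[OF I(1)] \<epsilon>(1) by blast
  moreover have "\<epsilon> j = \<alpha> j" using \<epsilon>(4)[of j] \<nu>j by simp
  ultimately show False using less by (metis le_funD not_le)
qed

text \<open>By the symmetry above, the sets of coordinates raised by the elements \<open>up (inc i \<alpha>)\<close> partition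
  \<open>I\<close>, so \<open>\<alpha>\<close> is their complete infimum as soon as there are two of them.\<close>

lemma well_behaved_up:
  assumes \<alpha>: "\<alpha> \<in> S - E" and two: "k \<in> I" "l \<in> I" "up (inc k \<alpha>) l = \<alpha> l"
    and G: "\<And>i. i \<in> I \<Longrightarrow> \<exists>G\<subseteq>I. (\<forall>h\<in>G. up (inc i \<alpha>) h = \<alpha> h) \<and>
      (\<forall>\<gamma>\<in>S. \<alpha> \<le> \<gamma> \<longrightarrow> (\<forall>h\<in>G. \<gamma> h = \<alpha> h) \<longrightarrow> \<gamma> \<notin> E)"
  shows False
proof -
  define \<nu> where "\<nu> i = up (inc i \<alpha>)" for i
  have \<alpha>S: "\<alpha> \<in> S" and \<alpha>I: "\<alpha> \<in> vecs I" using \<alpha> SI by auto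
  have incI: "inc i \<alpha> \<in> vecs I" if "i \<in> I" for i using \<alpha>I that by (rule inc_vecs)
  have \<nu>S: "\<nu> i \<in> S" and inc_\<nu>: "inc i \<alpha> \<le> \<nu> i" if "i \<in> I" for i
    using up[OF incI[OF that]] by (auto simp: \<nu>_def)
  have \<alpha>\<nu>: "\<alpha> \<le> \<nu> i" if "i \<in> I" for i using le_inc inc_\<nu>[OF that] by (rule order_trans)
  have \<nu>i: "\<alpha> i < \<nu> i i" if "i \<in> I" for i using le_funD[OF inc_\<nu>[OF that], of i] by simp
  \<comment> \<open>If \<open>\<nu> i\<close> raises \<open>j\<close>, it lies above
    \<open>inc j \<alpha>\<close> and hence above \<open>\<nu> j\<close>; by symmetry the two
    coincide. So distinct members raise disjoint sets of coordinates.\<close>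
  have le: "\<nu> j \<le> \<nu> i" if "i \<in> I" "j \<in> I" "\<alpha> j < \<nu> i j" for i j
    unfolding \<nu>_def[of j] using that
    by (intro up(3) incI \<nu>S inc_le \<alpha>\<nu>) auto
  have eq: "\<nu> i = \<nu> j" if "i \<in> I" "j \<in> I" "\<alpha> j < \<nu> i j" for i j
    using that le[of i j] le[of j i] up_inc_symmetric[OF \<alpha>S, of i j]
    by (auto simp: \<nu>_def intro: antisym)
  have min: "vmin (\<nu> i) (\<nu> j) = \<alpha>" if ij: "i \<in> I" "j \<in> I" "\<nu> i \<noteq> \<nu> j" for i j
  proof
    fix h
    show "vmin (\<nu> i) (\<nu> j) h = \<alpha> h"
    proof (cases "h \<in> I")
      case True
      have "\<not> (\<alpha> h < \<nu> i h \<and> \<alpha> h < \<nu> j h)" using eq[of i h] eq[of j h] ij True by metis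
      then show ?thesis
        using le_funD[OF \<alpha>\<nu>[OF ij(1)], of h] le_funD[OF \<alpha>\<nu>[OF ij(2)], of h]
        by (auto simp: vmin_def)
    next
      case False
      then show ?thesis
        using \<nu>S[OF ij(1)] \<nu>S[OF ij(2)] SI \<alpha>I by (auto simp: vmin_def vecs_def)
    qed
  qed
  \<comment> \<open>Repetitions among the \<open>\<nu> i\<close> are removed, because two equal
    members would not have minimum \<open>\<alpha>\<close>.\<close>
  define r where "r = card (\<nu> ` I)"
  obtain \<beta> where \<beta>: "bij_betw \<beta> {0..<r} (\<nu> ` I)"
    using ex_bij_betw_nat_finite[of "\<nu> ` I"] finI by (auto simp: r_def)
  have \<beta>_ex: "\<exists>i\<in>I. \<beta> j = \<nu> i" if "j < r" for j
    using bij_betwE[OF \<beta>] that by auto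
  define F where "F j = {h\<in>I. \<beta> j h = \<alpha> h}" for j
  have kl: "\<nu> k \<noteq> \<nu> l" using two(3) \<nu>i[OF two(2)] by (auto simp: \<nu>_def)
  have r: "2 \<le> r"
  proof -
    have "card {\<nu> k, \<nu> l} \<le> r" unfolding r_def using two finI by (intro card_mono) auto
    then show ?thesis using kl by simp
  qed
  have "\<exists>G\<subseteq>I. \<beta> j \<in> Deltat I S G \<alpha> \<and> Deltat I S G \<alpha> \<subseteq> S - E" if j: "j < r" for j
  proof -
    obtain i where i: "i \<in> I" "\<beta> j = \<nu> i" using \<beta>_ex[OF j] by blast
    from G[OF i(1)] obtain G where G: "G \<subseteq> I" "\<And>h. h \<in> G \<Longrightarrow> \<nu> i h = \<alpha> h"
      "\<And>\<gamma>. \<gamma> \<in> S \<Longrightarrow> \<alpha> \<le> \<gamma> \<Longrightarrow> (\<And>h. h \<in> G \<Longrightarrow> \<gamma> h = \<alpha> h) \<Longrightarrow> \<gamma> \<notin> E"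
      unfolding \<nu>_def by metis
    have "\<beta> j \<in> Deltat I S G \<alpha>"
      using G(2) \<nu>S[OF i(1)] \<alpha>\<nu>[OF i(1)] \<nu>i[OF i(1)] i(2) by (auto simp: Deltat_def le_fun_def)
    moreover have "Deltat I S G \<alpha> \<subseteq> S - E"
    proof
      fix \<gamma> assume \<gamma>: "\<gamma> \<in> Deltat I S G \<alpha>"
      have "\<alpha> \<le> \<gamma>"
      proof (rule le_funI)
        fix h show "\<alpha> h \<le> \<gamma> h"
          using \<gamma> \<alpha>I by (cases "h \<in> I"; cases "h \<in> G") (auto simp: Deltat_def vecs_def)
      qed
      then show "\<gamma> \<in> S - E" using \<gamma> G(3)[of \<gamma>] by (auto simp: Deltat_def)
    qed
    ultimately show ?thesis using G(1) by blast
  qed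
  then obtain G where "\<And>j. j < r \<Longrightarrow> G j \<subseteq> I \<and> \<beta> j \<in> Deltat I S (G j) \<alpha> \<and> Deltat I S (G j) \<alpha> \<subseteq> S - E"
    by metis
  moreover have "complete_inf I S S \<alpha> r \<beta> F"
  proof -
    have 1: "\<beta> j \<in> S \<and> \<beta> j \<in> Delta I S (F j) \<alpha> \<and> F j \<noteq> {} \<and> F j \<subset> I" if j: "j < r" for j
    proof -
      obtain i where i: "i \<in> I" "\<beta> j = \<nu> i" using \<beta>_ex[OF j] by blast
      have "\<beta> j \<in> Delta I S (F j) \<alpha>"
        using \<nu>S[OF i(1)] le_funD[OF \<alpha>\<nu>[OF i(1)]]
        by (auto simp: Delta_def F_def i(2) intro: order_neq_le_trans[OF not_sym])
      moreover have "F j \<noteq> {}"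
      proof -
        \<comment> \<open>As \<open>\<nu>\<close> takes two values, some \<open>\<nu> h\<close>
          differs from \<open>\<nu> i\<close>, and then \<open>\<nu> i\<close> keeps coordinate
          \<open>h\<close>.\<close>
        obtain h where h: "h \<in> I" "\<nu> h \<noteq> \<nu> i" using two kl by metis
        then have "\<not> \<alpha> h < \<nu> i h" using eq[OF i(1) h(1)] by auto
        then show ?thesis using h(1) le_funD[OF \<alpha>\<nu>[OF i(1)], of h] by (auto simp: F_def i(2))
      qed
      moreover have "i \<notin> F j" using \<nu>i[OF i(1)] by (simp add: F_def i(2))
      ultimately show ?thesis using i \<nu>S by (auto simp: F_def)
    qed
    have 2: "vmin (\<beta> j) (\<beta> m) = \<alpha>" if "j < r" "m < r" "j \<noteq> m" for j m
    proof -
      have "\<beta> j \<noteq> \<beta> m" using \<beta> that by (auto simp: bij_betw_def dest: inj_onD)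
      then show ?thesis using \<beta>_ex[OF that(1)] \<beta>_ex[OF that(2)] min by metis
    qed
    have 3: "(\<Inter>j\<in>{..<r}. F j) = {}"
    proof (rule equals0I)
      fix h assume h: "h \<in> (\<Inter>j\<in>{..<r}. F j)"
      moreover have "0 < r" using r by simp
      ultimately have "h \<in> I" by (auto simp: F_def)
      \<comment> \<open>The member \<open>\<nu> h\<close> raises \<open>h\<close>, so no coordinate
        is kept by the whole family.\<close>
      then obtain j where "j < r" "\<beta> j = \<nu> h"
        using bij_betw_imp_surj_on[OF \<beta>] by (metis atLeastLessThan_iff imageE imageI)
      moreover have "h \<in> F j" using h \<open>j < r\<close> by blast
      ultimately show False using \<nu>i[OF \<open>h \<in> I\<close>] by (simp add: F_def)
    qed
    show ?thesis unfolding complete_inf_def using \<alpha>S r 1 2 3 by blast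
  qed
  ultimately have "\<alpha> \<in> E" using wb \<alpha>S unfolding well_behaved_def by blast
  then show False using \<alpha> by simp
qed

text \<open>A jump at \<open>k\<close> would make \<open>\<alpha>\<close> a complete infimum of the
  kind excluded by well-behavedness: for each \<open>up (inc i \<alpha>)\<close>, either
  \<open>G\<close> or \<open>{k}\<close> serves as the set whose \<open>Deltat\<close> avoids
  \<open>E\<close>.\<close>

lemma no_jump_in_fibre:
  assumes \<alpha>: "\<alpha> \<in> S" and G: "G \<subseteq> I" "G \<noteq> {}"
    and fibre: "\<And>\<gamma>. \<gamma> \<in> S \<Longrightarrow> \<alpha> \<le> \<gamma> \<Longrightarrow> (\<And>h. h \<in> G \<Longrightarrow> \<gamma> h = \<alpha> h) \<Longrightarrow> \<gamma> \<notin> E"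
    and \<beta>: "\<beta> \<in> S" "\<alpha> \<le> \<beta>" "\<And>h. h \<in> G \<Longrightarrow> \<beta> h = \<alpha> h" and k: "k \<in> I" "\<alpha> k < \<beta> k"
  shows "\<not> jump S E \<alpha> k"
proof
  assume jump: "jump S E \<alpha> k"
  have \<alpha>A: "\<alpha> \<in> S - E" using \<alpha> fibre by blast
  have \<alpha>I: "\<alpha> \<in> vecs I" using \<alpha> SI by auto
  have le: "up (inc k \<alpha>) \<le> \<beta>" using \<beta> k \<alpha>I by (intro up(3) inc_vecs inc_le) auto
  have above: "\<alpha> \<le> up (inc i \<alpha>)" if "i \<in> I" for i
    using le_inc up(2)[OF inc_vecs[OF \<alpha>I that]] by (rule order_trans)
  have G_eq: "up (inc k \<alpha>) h = \<alpha> h" if "h \<in> G" for h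
    using le_funD[OF le, of h] le_funD[OF above[OF k(1)], of h] \<beta>(3)[OF that] by simp
  obtain l where l: "l \<in> G" using G by blast
  show False
  proof (rule well_behaved_up[OF \<alpha>A k(1) _ G_eq[OF l]])
    show "l \<in> I" using l G by blast
    fix i assume i: "i \<in> I"
    show "\<exists>G\<subseteq>I. (\<forall>h\<in>G. up (inc i \<alpha>) h = \<alpha> h) \<and>
      (\<forall>\<gamma>\<in>S. \<alpha> \<le> \<gamma> \<longrightarrow> (\<forall>h\<in>G. \<gamma> h = \<alpha> h) \<longrightarrow> \<gamma> \<notin> E)"
    proof (cases "\<alpha> k < up (inc i \<alpha>) k")
      case True
      \<comment> \<open>By symmetry \<open>up (inc i \<alpha>)\<close> lies below
        \<open>up (inc k \<alpha>)\<close>, hence it agrees with \<open>\<alpha>\<close> on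
        \<open>G\<close>.\<close>
      then have "\<alpha> i < up (inc k \<alpha>) i" using up_inc_symmetric[OF \<alpha> i k(1)] by blast
      then have "up (inc i \<alpha>) \<le> up (inc k \<alpha>)"
        using above[OF k(1)] up(1)[OF inc_vecs[OF \<alpha>I k(1)]] by (intro up(3) inc_vecs inc_le \<alpha>I i)
      then have "up (inc i \<alpha>) h = \<alpha> h" if "h \<in> G" for h
        using G_eq[OF that] le_funD[OF above[OF i], of h] by (metis le_antisym le_funD)
      then show ?thesis using G(1) fibre by (intro exI[of _ G]) simp
    next
      case False
      \<comment> \<open>Coordinate \<open>k\<close> is kept, and the jump at \<open>k\<close> says
        that no element of \<open>E\<close> above \<open>\<alpha>\<close> keeps it.\<close>
      then have "up (inc i \<alpha>) k = \<alpha> k" using le_funD[OF above[OF i], of k] by simp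
      then show ?thesis
        using jump k(1) by (intro exI[of _ "{k}"]) (auto simp: jump_def attains_def)
    qed
  qed
qed

text \<open>Climb from \<open>\<alpha>\<close> to \<open>\<beta>\<close> through elements of the
  form \<open>up (inc k \<alpha>)\<close>: they stay in the fibre, no step is a jump, and the
  hypothesis on \<open>E\<close> passes to the new starting point.\<close>

lemma rank_fibre:
  assumes "\<alpha> \<in> S" and G: "G \<subseteq> I" "G \<noteq> {}"
    and "\<And>\<gamma>. \<gamma> \<in> S \<Longrightarrow> \<alpha> \<le> \<gamma> \<Longrightarrow> (\<And>h. h \<in> G \<Longrightarrow> \<gamma> h = \<alpha> h) \<Longrightarrow> \<gamma> \<notin> E"
    and \<beta>: "\<beta> \<in> S" and "\<alpha> \<le> \<beta>" "\<And>h. h \<in> G \<Longrightarrow> \<beta> h = \<alpha> h"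
  shows "rank I S E \<beta> = rank I S E \<alpha>"
  using assms(1,4,6,7)
proof (induction "\<Sum>i\<in>I. \<beta> i - \<alpha> i" arbitrary: \<alpha> rule: less_induct)
  case (less \<alpha>)
  have \<alpha>I: "\<alpha> \<in> vecs I" and \<beta>I: "\<beta> \<in> vecs I" using less.prems(1) \<beta> SI by auto
  show ?case
  proof (cases "\<exists>k\<in>I. \<alpha> k < \<beta> k")
    case True
    then obtain k where k: "k \<in> I" "\<alpha> k < \<beta> k" by blast
    define \<nu> where "\<nu> = up (inc k \<alpha>)"
    have incI: "inc k \<alpha> \<in> vecs I" using \<alpha>I k(1) by (rule inc_vecs)
    have "\<not> jump S E \<alpha> k"
      using less.prems by (intro no_jump_in_fibre[where G = G and \<beta> = \<beta>] G \<beta> k) auto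
    then have rank: "rank I S E \<nu> = rank I S E \<alpha>"
      using k(1) by (simp add: \<nu>_def rank_up[OF incI] rank_inc)
    have \<nu>: "\<nu> \<in> S" "inc k \<alpha> \<le> \<nu>" "\<nu> \<le> \<beta>"
      using up[OF incI] \<beta> inc_le[OF less.prems(3) k(2)] by (auto simp: \<nu>_def)
    have \<alpha>\<nu>: "\<alpha> \<le> \<nu>" using le_inc \<nu>(2) by (rule order_trans)
    have eq: "\<nu> h = \<alpha> h" if "h \<in> G" for h
      using le_funD[OF \<nu>(3), of h] le_funD[OF \<alpha>\<nu>, of h] less.prems(4)[OF that] by simp
    have "(\<Sum>i\<in>I. \<beta> i - \<nu> i) < (\<Sum>i\<in>I. \<beta> i - \<alpha> i)"
      using finI k le_funD[OF \<nu>(2), of k] le_funD[OF \<alpha>\<nu>]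
      by (intro sum_strict_mono_ex1) (auto intro!: bexI[of _ k] diff_le_mono2)
    then have "rank I S E \<beta> = rank I S E \<nu>"
    proof (rule less.hyps[OF _ \<nu>(1) _ \<nu>(3)])
      show "\<gamma> \<notin> E" if "\<gamma> \<in> S" "\<nu> \<le> \<gamma>" "\<And>h. h \<in> G \<Longrightarrow> \<gamma> h = \<nu> h" for \<gamma>
        using that eq by (intro less.prems(2) order_trans[OF \<alpha>\<nu>]) auto
      show "\<beta> h = \<nu> h" if "h \<in> G" for h using that eq less.prems(4) by simp
    qed
    with rank show ?thesis by simp
  next
    case False
    have "\<alpha> k = \<beta> k" for k
      using False le_funD[OF less.prems(3), of k] \<alpha>I \<beta>I
      by (cases "k \<in> I") (auto simp: vecs_def)
    then have "\<alpha> = \<beta>" by blast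
    then show ?thesis by simp
  qed
qed

text \<open>First raise as many coordinates as one element of \<open>S\<close> above
  \<open>\<alpha>\<close> can raise while keeping a jump coordinate \<open>p\<close>; by
  \<open>rank_fibre\<close> this is free. Raising \<open>p\<close> then costs at most one, and the
  remaining steps turn out to be free.\<close>

lemma rank_inc_all:
  assumes \<alpha>: "\<alpha> \<in> S - E"
  shows "rank I S E (\<lambda>i. if i \<in> I then Suc (\<alpha> i) else \<alpha> i) \<le> Suc (rank I S E \<alpha>)"
proof -
  obtain p where p: "p \<in> I" "jump S E \<alpha> p" using ex_jump \<alpha> by blast
  have \<alpha>S: "\<alpha> \<in> S" and \<alpha>I: "\<alpha> \<in> vecs I" using \<alpha> SI by auto
  define W where "W \<beta> = {i\<in>I. \<alpha> i < \<beta> i}" for \<beta> :: vect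
  define Q where "Q \<beta> \<longleftrightarrow> \<beta> \<in> S \<and> \<alpha> \<le> \<beta> \<and> \<beta> p = \<alpha> p" for \<beta>
  have "\<exists>\<beta>. Q \<beta> \<and> (\<forall>\<gamma>. Q \<gamma> \<longrightarrow> card (W \<gamma>) \<le> card (W \<beta>))"
  proof (rule ex_has_greatest_nat[where b = "Suc (card I)"])
    show "Q \<alpha>" using \<alpha>S by (simp add: Q_def)
    show "\<forall>\<gamma>. Q \<gamma> \<longrightarrow> card (W \<gamma>) < Suc (card I)"
      using finI by (auto simp: W_def less_Suc_eq_le intro!: card_mono)
  qed
  then obtain \<beta> where \<beta>: "\<beta> \<in> S" "\<alpha> \<le> \<beta>" "\<beta> p = \<alpha> p"
    and max: "\<And>\<gamma>. Q \<gamma> \<Longrightarrow> card (W \<gamma>) \<le> card (W \<beta>)" unfolding Q_def by blast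
  have "rank I S E \<beta> = rank I S E \<alpha>"
    using p \<beta> by (intro rank_fibre[OF \<alpha>S, of "{p}"]) (auto simp: jump_def attains_def)
  define x where "x = (\<lambda>i. if i \<in> W \<beta> then Suc (\<alpha> i) else \<alpha> i)"
  define t where "t = (\<lambda>i. if i \<in> I then Suc (\<alpha> i) else \<alpha> i)"
  have "x \<le> \<beta>" using \<beta>(2) by (auto simp: x_def W_def le_fun_def)
  then have "rank I S E x \<le> rank I S E \<alpha>"
    using rank_mono \<beta>(1) SI \<open>rank I S E \<beta> = rank I S E \<alpha>\<close> by (metis subsetD)
  then have "rank I S E (inc p x) \<le> Suc (rank I S E \<alpha>)" using p(1) by (simp add: rank_inc)
  moreover have "rank I S E t = rank I S E (inc p x)"
  proof (rule rank_eqI)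
    show "inc p x \<le> t" using p(1) \<beta>(3) by (auto simp: x_def t_def W_def le_fun_def)
    show "t \<in> vecs I" using \<alpha>I by (auto simp: t_def vecs_def)
    fix z k assume k: "k \<in> I" and z: "inc p x \<le> z" "z \<le> t" "z k < t k"
    show "\<not> jump S E z k"
    proof
      assume "jump S E z k"
      \<comment> \<open>\<open>\<gamma>\<close> keeps \<open>k\<close> but raises \<open>p\<close>
        and all of \<open>W \<beta>\<close>. By (G2) at \<open>k\<close> it combines with
        \<open>\<beta>\<close> into an \<open>\<epsilon>\<close> that keeps \<open>p\<close> and
        raises \<open>k\<close> besides \<open>W \<beta>\<close>, against the maximality of
        \<open>\<beta>\<close>.\<close>
      then obtain \<gamma> where \<gamma>: "\<gamma> \<in> S" "z \<le> \<gamma>" "\<gamma> k = z k" by (auto simp: jump_def attains_def)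
      have x\<gamma>: "inc p x \<le> \<gamma>" using z(1) \<gamma>(2) by (rule order_trans)
      have \<alpha>\<gamma>: "\<alpha> h \<le> \<gamma> h" for h using le_funD[OF x\<gamma>, of h] by (auto simp: x_def split: if_splits)
      have \<gamma>p: "\<alpha> p < \<gamma> p" using le_funD[OF x\<gamma>, of p] by (auto simp: x_def split: if_splits)
      have \<gamma>k: "\<gamma> k = \<alpha> k" using \<gamma>(3) z(3) k \<alpha>\<gamma>[of k] by (simp add: t_def)
      have kW: "k \<notin> W \<beta>" using le_funD[OF x\<gamma>, of k] \<gamma>k by (auto simp: x_def split: if_splits)
      then have "\<beta> k = \<alpha> k" using k le_funD[OF \<beta>(2), of k] by (simp add: W_def)
      then have "\<beta> k = \<gamma> k" "\<beta> \<noteq> \<gamma>" using \<gamma>k \<gamma>p \<beta>(3) by auto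
      from G2_elim[OF G2S SI \<beta>(1) \<gamma>(1) k this(2,1)]
      obtain \<epsilon> where \<epsilon>: "\<epsilon> \<in> S" "\<beta> k < \<epsilon> k" "vmin \<beta> \<gamma> \<le> \<epsilon>"
        "\<And>j. \<beta> j \<noteq> \<gamma> j \<Longrightarrow> \<epsilon> j = min (\<beta> j) (\<gamma> j)" by blast
      have \<epsilon>p: "\<epsilon> p = \<alpha> p" using \<epsilon>(4)[of p] \<gamma>p \<beta>(3) by simp
      have ge: "min (\<beta> h) (\<gamma> h) \<le> \<epsilon> h" for h using le_funD[OF \<epsilon>(3), of h] by (simp add: vmin_def)
      have "\<alpha> h \<le> \<epsilon> h" for h using ge[of h] \<alpha>\<gamma>[of h] le_funD[OF \<beta>(2), of h] by simp
      then have "Q \<epsilon>" using \<epsilon>(1) \<epsilon>p by (auto simp: Q_def le_fun_def)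
      moreover have "insert k (W \<beta>) \<subseteq> W \<epsilon>"
      proof -
        have "h \<in> W \<epsilon>" if h: "h \<in> W \<beta>" for h
        proof -
          have "\<alpha> h < \<gamma> h" using le_funD[OF x\<gamma>, of h] h by (auto simp: x_def split: if_splits)
          then show ?thesis using h ge[of h] by (auto simp: W_def)
        qed
        moreover have "k \<in> W \<epsilon>" using k \<epsilon>(2) \<open>\<beta> k = \<alpha> k\<close> by (simp add: W_def)
        ultimately show ?thesis by blast
      qed
      then have "card (insert k (W \<beta>)) \<le> card (W \<epsilon>)" using finI by (intro card_mono) (auto simp: W_def)
      moreover have "finite (W \<beta>)" using finI by (simp add: W_def)
      ultimately show False using max[of \<epsilon>] kW by simp
    qed
  qed
  ultimately show ?thesis by (simp add: t_def)
qed

end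

section \<open>From the rank to the levels\<close>

context good_pair
begin

text \<open>The bound is a hypothesis because its source varies: for \<open>(S, E)\<close> it is
  \<open>rank_inc_all\<close>, for a projection it is inherited from \<open>(S, E)\<close>.\<close>

lemma level_eq_rank_if_inc_all:
  assumes inc_all: "\<And>\<alpha>. \<alpha> \<in> S - E \<Longrightarrow>
      rank I S E (\<lambda>i. if i \<in> I then Suc (\<alpha> i) else \<alpha> i) \<le> Suc (rank I S E \<alpha>)"
    and zero: "vzero \<in> S - E"
  shows "level I S (S - E) i = {\<alpha>\<in>S - E. Suc (rank I S E \<alpha>) = i}"
proof -
  obtain N where N: "\<And>\<alpha>. \<alpha> \<in> S - E \<Longrightarrow> rank I S E \<alpha> < N"
    "\<And>x. x \<in> vecs I \<Longrightarrow> rank I S E x < N \<Longrightarrow> \<exists>\<beta>\<in>S - E. x \<le> \<beta> \<and> rank I S E \<beta> = rank I S E x"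
    using rank_boundE by blast
  show ?thesis
  proof (rule level_eq_rank[where N = N])
    fix \<alpha> assume \<alpha>: "\<alpha> \<in> S - E" "Suc (rank I S E \<alpha>) < N"
    let ?t = "\<lambda>i. if i \<in> I then Suc (\<alpha> i) else \<alpha> i"
    have t: "?t \<in> vecs I" using \<alpha>(1) SI by (auto simp: vecs_def)
    \<comment> \<open>\<open>\<beta>\<close> has the rank of the raised point, hence at most
      \<open>Suc\<close> of the rank of \<open>\<alpha>\<close>; being strictly above
      \<open>\<alpha>\<close> everywhere, it has at least that rank.\<close>
    then obtain \<beta> where \<beta>: "\<beta> \<in> S - E" "?t \<le> \<beta>" "rank I S E \<beta> = rank I S E ?t"
      using N(2)[OF t] inc_all[OF \<alpha>(1)] \<alpha>(2) by auto
    have less: "vll I \<alpha> \<beta>" unfolding vll_def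
    proof
      fix k assume "k \<in> I" then show "\<alpha> k < \<beta> k" using le_funD[OF \<beta>(2), of k] by simp
    qed
    then have "rank I S E \<alpha> < rank I S E \<beta>" using \<beta>(1) by (intro rank_vll[OF \<alpha>(1)]) auto
    then show "\<exists>\<beta>\<in>S - E. vll I \<alpha> \<beta> \<and> rank I S E \<beta> = Suc (rank I S E \<alpha>)"
      using \<beta> less inc_all[OF \<alpha>(1)] by (intro bexI[of _ \<beta>]) auto
  next
    show "\<exists>\<alpha>\<in>S - E. rank I S E \<alpha> = 0"
      using zero by (intro bexI[of _ vzero]) (simp_all add: rank_def path_sum_vzero)
  qed (use N rank_vll rank_complete_inf in auto)
qed

end

section \<open>Projections\<close>

lemma proj_vecs: "proj J x \<in> vecs J"
  by (simp add: proj_def vecs_def)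

lemma vecs_mono: "J \<subseteq> I \<Longrightarrow> vecs J \<subseteq> vecs I"
  by (auto simp: vecs_def)

lemma G1_proj: "G1 I T \<Longrightarrow> G1 J (proj J ` T)"
proof -
  assume "G1 I T"
  moreover have "vmin (proj J \<alpha>) (proj J \<beta>) = proj J (vmin \<alpha> \<beta>)" for \<alpha> \<beta>
    by (auto simp: vmin_def proj_def)
  ultimately show ?thesis by (auto simp: G1_def)
qed

lemma G2_proj:
  assumes "G2 I T" "J \<subseteq> I"
  shows "G2 J (proj J ` T)"
  unfolding G2_def
proof (intro ballI impI)
  fix a b i assume ab: "a \<in> proj J ` T" "b \<in> proj J ` T" "i \<in> J" "a \<noteq> b \<and> a i = b i"
  then obtain \<alpha> \<beta> where a: "a = proj J \<alpha>" "b = proj J \<beta>" and "\<alpha> \<in> T" "\<beta> \<in> T" by blast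
  with ab have *: "i \<in> J" "proj J \<alpha> \<noteq> proj J \<beta>" "proj J \<alpha> i = proj J \<beta> i" "\<alpha> \<in> T" "\<beta> \<in> T"
    by auto
  have eq: "proj J x j = x j" if "j \<in> J" for x j using that by (simp add: proj_def)
  have i: "i \<in> I" "\<alpha> \<noteq> \<beta> \<and> \<alpha> i = \<beta> i" using * assms(2) eq by auto
  with assms(1) *(4,5) obtain \<epsilon> where \<epsilon>: "\<epsilon> \<in> T" "\<alpha> i < \<epsilon> i"
    "\<And>j. j \<in> I - {i} \<Longrightarrow> min (\<alpha> j) (\<beta> j) \<le> \<epsilon> j \<and> (\<alpha> j \<noteq> \<beta> j \<longrightarrow> \<epsilon> j = min (\<alpha> j) (\<beta> j))"
    unfolding G2_def by metis
  show "\<exists>\<epsilon>\<in>proj J ` T. a i < \<epsilon> i \<and> (\<forall>j\<in>J - {i}. min (a j) (b j) \<le> \<epsilon> j \<and>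
      (a j \<noteq> b j \<longrightarrow> \<epsilon> j = min (a j) (b j)))"
    unfolding a by (rule bexI[of _ "proj J \<epsilon>"]) (use \<epsilon> *(1) assms(2) eq in auto)
qed

lemma G3_proj:
  assumes "G3 I T" "J \<subseteq> I"
  shows "G3 J (proj J ` T)"
proof -
  from assms obtain c where c: "\<And>\<gamma>. \<gamma> \<in> vecs I \<Longrightarrow> vadd c \<gamma> \<in> T" by (auto simp: G3_def)
  have "vadd (proj J c) \<gamma> \<in> proj J ` T" if "\<gamma> \<in> vecs J" for \<gamma>
  proof -
    have "vadd (proj J c) \<gamma> = proj J (vadd c \<gamma>)" using that by (auto simp: vadd_def proj_def vecs_def)
    then show ?thesis using c vecs_mono[OF assms(2)] that by blast
  qed
  then show ?thesis using proj_vecs by (auto simp: G3_def)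
qed

text \<open>As \<open>x\<close> vanishes outside \<open>J\<close>, lying above \<open>x\<close> is a
  condition on the coordinates in \<open>J\<close> alone.\<close>

lemma attains_proj:
  assumes "x \<in> vecs J" "i \<in> J"
  shows "attains (proj J ` T) x i \<longleftrightarrow> attains T x i"
proof -
  have "x \<le> proj J \<gamma> \<longleftrightarrow> x \<le> \<gamma>" for \<gamma>
    using assms(1) by (auto simp: le_fun_def proj_def vecs_def)
  then show ?thesis using assms(2) by (auto simp: attains_def proj_def)
qed

lemma (in good_pair) good_pair_proj:
  assumes "J \<subseteq> I"
  shows "good_pair J (proj J ` S) (proj J ` E)"
  using assms finI ES G1S G2S G1E G2E G3E
  by unfold_locales (auto intro: finite_subset G1_proj G2_proj G3_proj proj_vecs[THEN subsetD[OF order_refl]])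

text \<open>A path from \<open>0\<close> to a point supported on \<open>J\<close> uses only
  directions in \<open>J\<close>, where the jumps of both pairs coincide.\<close>

lemma (in good_pair) rank_proj:
  assumes J: "J \<subseteq> I" and x: "x \<in> vecs J"
  shows "rank J (proj J ` S) (proj J ` E) x = rank I S E x"
proof -
  interpret J: good_pair J "proj J ` S" "proj J ` E" by (rule good_pair_proj[OF J])
  have "vzero \<le> x" by (simp add: vzero_def le_fun_def)
  then show ?thesis
  proof (rule path_induct[OF J.finI x, where P = "\<lambda>z. rank J (proj J ` S) (proj J ` E) z = rank I S E z"])
    show "rank J (proj J ` S) (proj J ` E) vzero = rank I S E vzero"
      by (simp add: rank_def path_sum_vzero)
    fix z i assume z: "i \<in> J" "z \<le> x" "rank J (proj J ` S) (proj J ` E) z = rank I S E z"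
    have "z \<in> vecs J" using z(2) x by (rule vecs_le)
    then have "jump (proj J ` S) (proj J ` E) z i = jump S E z i"
      using z(1) by (simp add: jump_def attains_proj)
    then show "rank J (proj J ` S) (proj J ` E) (inc i z) = rank I S E (inc i z)"
      using z J by (simp add: rank_inc J.rank_inc subset_eq)
  qed
qed

text \<open>Read the projection \<open>a\<close> as a vector on \<open>I\<close> padded by zeros.
  Then \<open>up a\<close> is the least element of \<open>S\<close> over \<open>a\<close> and has
  the rank of \<open>a\<close>; the fibre over \<open>a\<close> avoids \<open>E\<close>, so
  \<open>rank_fibre\<close> carries the rank from \<open>up a\<close> to
  \<open>\<alpha>\<close>.\<close>

lemma (in well_behaved_pair) rank_proj_fibre:
  assumes J: "J \<subseteq> I" "J \<noteq> {}" and \<alpha>: "\<alpha> \<in> S" "proj J \<alpha> \<notin> proj J ` E"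
  shows "rank J (proj J ` S) (proj J ` E) (proj J \<alpha>) = rank I S E \<alpha>"
proof -
  define a where "a = proj J \<alpha>"
  have aJ: "a \<in> vecs J" by (simp add: a_def proj_vecs)
  then have aI: "a \<in> vecs I" using vecs_mono[OF J(1)] by blast
  have a\<alpha>: "a \<le> \<alpha>" by (simp add: a_def proj_def le_fun_def)
  have le: "up a \<le> \<alpha>" using up(3)[OF aI \<alpha>(1) a\<alpha>] .
  have eq: "up a h = \<alpha> h" if "h \<in> J" for h
    using le_funD[OF le, of h] le_funD[OF up(2)[OF aI], of h] that by (simp add: a_def proj_def)
  have "rank I S E \<alpha> = rank I S E (up a)"
  proof (rule rank_fibre[OF up(1)[OF aI] J _ \<alpha>(1) le])
    show "\<gamma> \<notin> E" if "\<And>h. h \<in> J \<Longrightarrow> \<gamma> h = up a h" for \<gamma>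
    proof
      assume "\<gamma> \<in> E"
      moreover have "proj J \<gamma> = proj J \<alpha>" using that eq by (auto simp: proj_def)
      ultimately show False using \<alpha>(2) by (metis imageI)
    qed
  qed (simp add: eq)
  then show ?thesis using rank_up[OF aI] rank_proj[OF J(1) aJ] by (simp add: a_def)
qed

lemma level_proj_fibre:
  assumes S: "good_semigroup I S" and loc: "local_semigroup I S" and E: "good_ideal I S E" "E \<noteq> S"
    and wb: "well_behaved I S E" and fin: "finite I" and J: "J \<subseteq> I" "J \<noteq> {}"
    and a: "a \<in> level J (proj J ` S) (proj J ` S - proj J ` E) i"
  shows "{\<alpha>\<in>S. proj J \<alpha> = a} \<subseteq> level I S (S - E) i"
proof -
  interpret well_behaved_pair I S E
    using S E wb fin by unfold_locales (auto simp: good_semigroup_def good_ideal_def)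
  interpret J: good_pair J "proj J ` S" "proj J ` E" by (rule good_pair_proj[OF J(1)])
  have zS: "vzero \<in> S" using S by (simp add: good_semigroup_def)
  \<comment> \<open>An ideal containing \<open>0\<close> would be all of \<open>S\<close>.\<close>
  have zE: "vzero \<notin> E"
  proof
    assume z: "vzero \<in> E"
    have "\<alpha> \<in> E" if "\<alpha> \<in> S" for \<alpha>
    proof -
      have "vadd vzero \<alpha> \<in> E" using E(1) z that by (auto simp: good_ideal_def)
      then show ?thesis by (simp add: vadd_def vzero_def)
    qed
    then show False using E(2) ES by blast
  qed
  \<comment> \<open>By locality an element of \<open>E\<close> vanishing on the nonempty set
    \<open>J\<close> would be \<open>0\<close>. Hence \<open>0\<close> lies outside both ideals, and
    both numberings start at rank \<open>0\<close>.\<close>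
  have "vzero \<notin> proj J ` E"
  proof
    assume "vzero \<in> proj J ` E"
    then obtain \<eta> where \<eta>: "\<eta> \<in> E" "vzero = proj J \<eta>" by blast
    obtain k where k: "k \<in> J" using J by blast
    then have "\<eta> k = 0" using fun_cong[OF \<eta>(2), of k] by (simp add: vzero_def proj_def)
    then have "\<eta> = vzero" using loc \<eta>(1) ES J k by (auto simp: local_semigroup_def)
    then show False using \<eta> zE by simp
  qed
  moreover have "proj J vzero = vzero" by (auto simp: proj_def vzero_def)
  ultimately have zJ: "vzero \<in> proj J ` S - proj J ` E" using zS by (metis DiffI imageI)
  have level: "level I S (S - E) i = {\<alpha>\<in>S - E. Suc (rank I S E \<alpha>) = i}"
    using zS zE rank_inc_all by (intro level_eq_rank_if_inc_all) auto
  have levelJ: "level J (proj J ` S) (proj J ` S - proj J ` E) i =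
    {x\<in>proj J ` S - proj J ` E. Suc (rank J (proj J ` S) (proj J ` E) x) = i}"
  proof (rule J.level_eq_rank_if_inc_all[OF _ zJ])
    fix x assume "x \<in> proj J ` S - proj J ` E"
    then obtain \<alpha> where \<alpha>: "\<alpha> \<in> S" "x = proj J \<alpha>" "proj J \<alpha> \<notin> proj J ` E" by auto
    let ?t = "\<lambda>i. if i \<in> J then Suc (x i) else x i"
    let ?u = "\<lambda>i. if i \<in> I then Suc (\<alpha> i) else \<alpha> i"
    have t: "?t \<in> vecs J" using \<alpha>(2) by (auto simp: vecs_def proj_def)
    have u: "?u \<in> vecs I" using \<alpha>(1) SI by (auto simp: vecs_def)
    \<comment> \<open>The bound is transferred from \<open>(S, E)\<close>: raising
      \<open>\<alpha>\<close> everywhere dominates raising its projection, and the ranks of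
      \<open>\<alpha>\<close> and its projection agree.\<close>
    have "?t \<le> ?u" using \<alpha>(2) J by (auto simp: le_fun_def proj_def)
    then have "rank J (proj J ` S) (proj J ` E) ?t \<le> rank I S E ?u"
      using rank_proj[OF J(1) t] rank_mono u by simp
    also have "\<dots> \<le> Suc (rank I S E \<alpha>)" using \<alpha> by (intro rank_inc_all) auto
    also have "\<dots> = Suc (rank J (proj J ` S) (proj J ` E) x)"
      using rank_proj_fibre[OF J \<alpha>(1,3)] \<alpha>(2) by simp
    finally show "rank J (proj J ` S) (proj J ` E) ?t \<le> Suc (rank J (proj J ` S) (proj J ` E) x)" .
  qed
  show ?thesis
  proof clarify
    fix \<alpha> assume \<alpha>: "\<alpha> \<in> S" "a = proj J \<alpha>"
    have "proj J \<alpha> \<notin> proj J ` E" "Suc (rank J (proj J ` S) (proj J ` E) (proj J \<alpha>)) = i"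
      using a \<alpha>(2) unfolding levelJ by auto
    then show "\<alpha> \<in> level I S (S - E) i"
      using \<alpha>(1) rank_proj_fibre[OF J \<alpha>(1)] unfolding level by auto
  qed
qed

theorem theorem5p6:
  fixes d :: nat and S E :: "vect set" and I1 I2 :: "nat set" and i :: nat
  assumes "good_semigroup {1..d} S" and "local_semigroup {1..d} S"
    and "good_ideal {1..d} S E" and "E \<noteq> S"
    and "well_behaved {1..d} S E"
    and "I1 \<union> I2 = {1..d}" and "I1 \<inter> I2 = {}" and "I1 \<noteq> {}" and "I2 \<noteq> {}"
  shows "(\<forall>\<alpha>1 \<in> level I1 (proj I1 ` S) (proj I1 ` S - proj I1 ` E) i.
            {\<alpha>\<in>S. proj I1 \<alpha> = \<alpha>1} \<subseteq> level {1..d} S (S - E) i)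
       \<and> (\<forall>\<alpha>2 \<in> level I2 (proj I2 ` S) (proj I2 ` S - proj I2 ` E) i.
            {\<alpha>\<in>S. proj I2 \<alpha> = \<alpha>2} \<subseteq> level {1..d} S (S - E) i)"
proof -
  have "I1 \<subseteq> {1..d}" "I2 \<subseteq> {1..d}" using assms(6) by auto
  then show ?thesis
    using level_proj_fibre[OF assms(1-5) finite_atLeastAtMost] assms(8,9) by blast
qed

end
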